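(* Suppose that, with constants $\varepsilon_{\mathcal G}, C_c, C_d>0$, the coarse solver $\mathcal G$ and $\delta\mathcal G=\mathcal E-\mathcal G$ satisfy, for all $x,y\in\mathbb U$, all $t\in[0,T[$ and all $s\in[0,T-t]$, $$\|\delta\mathcal G(t,s,x)\|\le s\,(1+\|x\|)\,\varepsilon_{\mathcal G},$$ $$\|\mathcal G(t,s,x)-\mathcal G(t,s,y)\|\le (1+C_c s)\,\|x-y\|,$$ $$\|\delta\mathcal G(t,s,x)-\delta\mathcal G(t,s,y)\|\le C_d\, s\,\varepsilon_{\mathcal G}\,\|x-y\|.$$ Let $(y^N_k)_{0\le N\le \underline N,\ k\ge 0}$ be defined by the feasible parareal scheme $$y^0_k=u(0)\quad (k\ge 0),\qquad y_0^{N+1}=\mathcal G(T_N,\Delta T,y_0^N)\quad (0\le N\le \underline N-1),$$ $$y_{k+1}^{N+1}=\mathcal G(T_N,\Delta T,y_{k+1}^N)+[\mathcal E(T_N,\Delta T,y_k^N);\zeta_k^N]-\mathcal G(T_N,\Delta T,y_k^N)\quad (0\le N\le \underline N-1,\ k\ge 0).$$ Let $k\ge 0$ be any given integer. If for all $0\le p<k$ and all $0\le N<\underline N$ the approximation $[\mathcal E(T_N,\Delta T,y_p^N);\zeta_p^N]$ has accuracy $$\zeta_p^N\le \zeta_p:=\frac{\varepsilon_{\mathcal G}^{\,p+2}}{(p+1)!\,\nu_p},\qquad \nu_p:=\frac{\max_{0\le N\le\underline N}(1+\|y_p^N\|)}{\max_{0\le N\le\underline N}(1+\|u(T_N)\|)},$$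 then $$\max_{0\le N\le \underline N}\|u(T_N)-y_k^N\|\le \mu\,\frac{\tilde\tau^{\,k+1}}{(k+1)!},$$ where $$\mu=\frac{e^{C_cT}}{C_d}\max_{0\le N\le \underline N}(1+\|u(T_N)\|),\qquad \tilde\tau=\tau+\varepsilon_{\mathcal G},\qquad \tau=C_d\,T\,e^{-C_c\Delta T}\,\varepsilon_{\mathcal G}.$$
   Context: Let $\mathbb U$ be a Banach space of functions defined over a domain $\Omega\subset\mathbb R^d$ ($d\ge 1$), with norm $\|\cdot\|$, and let $T>0$. The exact propagator $\mathcal E$ is an operator such that, for $t\in[0,T]$, $s\in[0,T-t]$ and $w\in\mathbb U$, $\mathcal E(t,s,w)\in\mathbb U$ is the value at time $t+s$ of the solution, with value $w$ at time $t$, of the evolution problem $u'(t)+\mathcal A(t,u(t))=0$, $t\in[0,T]$, where $\mathcal A:[0,T]\times\mathbb U\to\mathbb U$ is an operator regular enough that this is well defined. $\mathcal E$ satisfies the semigroup property $\mathcal E(r,t-r,w)=\mathcal E(s,t-s,\mathcal E(r,s-r,w))$ for all $w\in\mathbb U$ and $r<s<t$ in $[0,T]$. The function $u\in\mathcal C^1([0,T],\mathbb U)$ denotes the solution of the evolution problem with given initial condition $u(0)\in\mathbb U$, so $u(t)=\mathcal E(0,t,u(0))$. The interval $[0,T]$ is divided into $\underline N\geq 1$ subintervals of equal size $\Delta T=T/\underline N$, with $T_N=N\Delta T$ for $0\le N\le\underline N$. The coarse solver $\mathcal G$ is an operator with the same arguments as $\mathcal E$ and values in $\mathbb U$: $\mathcal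 G(t,s,w)\in\mathbb U$ for $t\in[0,T]$, $s\in[0,T-t]$, $w\in\mathbb U$. Notation $[\mathcal E(t,s,w);\zeta]$: for $w\in\mathbb U$, $t\in[0,T[$, $s\in[0,T-t]$ and $\zeta>0$, $[\mathcal E(t,s,w);\zeta]$ denotes an (arbitrarily chosen) element of $\mathbb U$ that approximates $\mathcal E(t,s,w)$ with accuracy $\zeta$ in the sense that $$\|\mathcal E(t,s,w)-[\mathcal E(t,s,w);\zeta]\|\le \zeta\,s\,(1+\|w\|).$$ In the feasible parareal scheme, $\zeta_k^N>0$ are the accuracies of the approximations used at iteration $k$ on $[T_N,T_{N+1}]$. *)

theory Defs
  imports "HOL-Analysis.Analysis"
begin

text \<open>
  The Banach space of functions is an arbitrary type of class \<open>banach\<close>. Operators such as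
  \<open>\<A>(t, w)\<close>, \<open>\<E>(t, s, w)\<close> and \<open>\<G>(t, s, w)\<close> are total curried functions, whose values are
  only used for \<open>t \<in> [0, T]\<close> and \<open>s \<in> [0, T - t]\<close>.
\<close>

text \<open>\<open>v\<close> is a \<open>C\<^sup>1\<close> solution on \<open>[t, T]\<close> of \<open>v'(r) + A(r, v(r)) = 0\<close> with \<open>v(t) = w\<close>;
  derivatives at the end points are one-sided.\<close>

definition evolution_solution ::
  "(real \<Rightarrow> 'u \<Rightarrow> 'u) \<Rightarrow> real \<Rightarrow> real \<Rightarrow> 'u \<Rightarrow> (real \<Rightarrow> 'u::banach) \<Rightarrow> bool" where
  "evolution_solution A T t w v \<longleftrightarrow>
     v t = w \<and>
     (\<exists>v'. continuous_on {t..T} v' \<and>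
           (\<forall>r\<in>{t..T}. (v has_vector_derivative v' r) (at r within {t..T}) \<and>
                       v' r + A r (v r) = 0))"

text \<open>The regularity required of \<open>A\<close> is exactly that the evolution problem is well posed: from
  every \<open>t \<in> [0, T]\<close> and every \<open>w\<close>, the curve \<open>r \<mapsto> E(t, r - t, w)\<close> is the one and only solution
  on \<open>[t, T]\<close>.\<close>

definition exact_propagator ::
  "(real \<Rightarrow> 'u \<Rightarrow> 'u) \<Rightarrow> real \<Rightarrow> (real \<Rightarrow> real \<Rightarrow> 'u \<Rightarrow> 'u::banach) \<Rightarrow> bool" where
  "exact_propagator A T E \<longleftrightarrow>
     (\<forall>t\<in>{0..T}. \<forall>w.
        evolution_solution A T t w (\<lambda>r. E t (r - t) w) \<and>
        (\<forall>v. evolution_solution A T t w v \<longrightarrow> (\<forall>r\<in>{t..T}. v r = E t (r - t) w)))"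

definition semigroup_property ::
  "real \<Rightarrow> (real \<Rightarrow> real \<Rightarrow> 'u \<Rightarrow> 'u::banach) \<Rightarrow> bool" where
  "semigroup_property T E \<longleftrightarrow>
     (\<forall>w r s t. 0 \<le> r \<and> r < s \<and> s < t \<and> t \<le> T \<longrightarrow>
        E r (t - r) w = E s (t - s) (E r (s - r) w))"

text \<open>\<open>a\<close> is an admissible choice for \<open>[E(t, s, w); \<zeta>]\<close>.\<close>

definition approximates ::
  "(real \<Rightarrow> real \<Rightarrow> 'u \<Rightarrow> 'u::banach) \<Rightarrow> real \<Rightarrow> real \<Rightarrow> 'u \<Rightarrow> real \<Rightarrow> 'u \<Rightarrow> bool" where
  "approximates E t s w \<zeta> a \<longleftrightarrow> norm (E t s w - a) \<le> \<zeta> * s * (1 + norm w)"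

text \<open>Here \<open>n\<close> is the number of subintervals, \<open>y k N\<close> is the iterate \<open>y\<^sub>k\<^sup>N\<close>, and \<open>e k N\<close> is the
  element chosen for \<open>[E(T\<^sub>N, \<Delta>T, y\<^sub>k\<^sup>N); \<zeta>\<^sub>k\<^sup>N]\<close>. Choosing it separately for each pair \<open>(k, N)\<close>
  allows equal arguments to receive different approximations.\<close>

definition feasible_parareal ::
  "(real \<Rightarrow> real \<Rightarrow> 'u \<Rightarrow> 'u) \<Rightarrow> (real \<Rightarrow> real \<Rightarrow> 'u \<Rightarrow> 'u) \<Rightarrow> real \<Rightarrow> nat \<Rightarrow> 'u \<Rightarrow>
   (nat \<Rightarrow> nat \<Rightarrow> real) \<Rightarrow> (nat \<Rightarrow> nat \<Rightarrow> 'u) \<Rightarrow> (nat \<Rightarrow> nat \<Rightarrow> 'u::banach) \<Rightarrow> bool" where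
  "feasible_parareal E G \<Delta>T n u0 \<zeta> e y \<longleftrightarrow>
     (\<forall>k. \<forall>N<n. \<zeta> k N > 0 \<and> approximates E (real N * \<Delta>T) \<Delta>T (y k N) (\<zeta> k N) (e k N)) \<and>
     (\<forall>k. y k 0 = u0) \<and>
     (\<forall>N<n. y 0 (Suc N) = G (real N * \<Delta>T) \<Delta>T (y 0 N)) \<and>
     (\<forall>k. \<forall>N<n. y (Suc k) (Suc N) =
        G (real N * \<Delta>T) \<Delta>T (y (Suc k) N) + e k N - G (real N * \<Delta>T) \<Delta>T (y k N))"

end

theory Submission
  imports Defs
begin

text \<open>
  Let $M = \max_N (1 + \|u(T_N)\|)$, $q = e^{C_c \Delta T}$ and $\theta = C_d \Delta T \epsilon / q$.
  Splitting $\mathcal E = \mathcal G + \delta\mathcal G$ shows that the errors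
  $d_k^N = \|u(T_N) - y_k^N\|$ satisfy
  $d_{k+1}^{N+1} \le q\, d_{k+1}^N + q \theta\, d_k^N + (M / C_d)\, q \theta\, \epsilon^{k+1} / (k+1)!$,
  where the last term comes from the inexact fine solver. Induction on $N$ yields
  $d_k^N \le (M / C_d)\, q^N ((\epsilon + N \theta)^{k+1} - \epsilon^{k+1}) / (k+1)!$, in which the
  induction step is Bernoulli's inequality. The claim follows because $q^{\underline N} = e^{C_c T}$
  and $\underline N \theta = \tau$.
\<close>

text \<open>The left side consists of the first two terms of the binomial expansion of the right
  side, and all other terms are nonnegative. In this homogeneous form of Bernoulli's inequality
  nothing is divided by \<open>x\<close>, so \<open>x = 0\<close> is covered.\<close>

lemma power_Suc_add_ge:
  fixes x h :: real
  assumes "0 \<le> x" and "0 \<le> h"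
  shows "x ^ Suc m + real (Suc m) * h * x ^ m \<le> (x + h) ^ Suc m"
proof (induction m)
  case 0
  then show ?case by simp
next
  case (Suc m)
  \<comment> \<open>Multiplying out the right side leaves the surplus
    \<open>real (Suc m) * h * h * x ^ m\<close>, which is dropped.\<close>
  have "x ^ Suc (Suc m) + real (Suc (Suc m)) * h * x ^ Suc m
      \<le> (x + h) * (x ^ Suc m + real (Suc m) * h * x ^ m)"
    using assms by (simp add: algebra_simps)
  also have "\<dots> \<le> (x + h) * (x + h) ^ Suc m"
    using Suc.IH assms by (intro mult_left_mono) auto
  finally show ?case by simp
qed

text \<open>Subtracting \<open>\<epsilon> ^ Suc p\<close> serves twice: the bound vanishes at
  \<open>N = 0\<close>, as \<open>start\<close> demands, and the forcing term cancels in the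
  induction step. The induction keeps \<open>p\<close> arbitrary because \<open>step\<close> draws
  on both \<open>p\<close> and \<open>Suc p\<close> at the same \<open>N\<close>.\<close>

lemma two_index_recurrence_bound:
  fixes d :: "nat \<Rightarrow> nat \<Rightarrow> real"
  assumes q: "1 \<le> q" and nonneg: "0 \<le> c" "0 \<le> \<epsilon>" "0 \<le> \<theta>"
    and start: "\<And>p. p \<le> k \<Longrightarrow> d p 0 \<le> 0"
    and step0: "\<And>N. N < n \<Longrightarrow> d 0 (Suc N) \<le> q * d 0 N + c * (q * \<theta>)"
    and step: "\<And>p N. \<lbrakk>p < k; N < n\<rbrakk> \<Longrightarrow>
      d (Suc p) (Suc N) \<le> q * d (Suc p) N + q * \<theta> * d p N + c * (q * \<theta>) * (\<epsilon> ^ Suc p / fact (Suc p))"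
  shows "\<lbrakk>N \<le> n; p \<le> k\<rbrakk> \<Longrightarrow>
    d p N \<le> c * q ^ N * (((\<epsilon> + real N * \<theta>) ^ Suc p - \<epsilon> ^ Suc p) / fact (Suc p))"
proof (induction N arbitrary: p)
  case 0
  then show ?case using start by simp
next
  case (Suc N)
  define x where "x = \<epsilon> + real N * \<theta>"
  have x: "0 \<le> x" and x_Suc: "\<epsilon> + real (Suc N) * \<theta> = x + \<theta>"
    using nonneg by (auto simp: x_def algebra_simps)
  have IH: "d i N \<le> c * q ^ N * ((x ^ Suc i - \<epsilon> ^ Suc i) / fact (Suc i))" if "i \<le> k" for i
    using Suc that by (simp add: x_def)
  have qN: "1 \<le> q ^ N" and q0: "0 \<le> q"
    using q by (auto intro: one_le_power)
  \<comment> \<open>The forcing lacks the growth factor \<open>q ^ N\<close>. Since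
    \<open>1 \<le> q ^ N\<close>, inserting it only enlarges the bound and gives all terms the
    common prefactor \<open>c * q ^ Suc N\<close>.\<close>
  have absorb: "c * (q * \<theta>) * f \<le> c * q ^ Suc N * (\<theta> * f)" if "0 \<le> f" for f
  proof -
    have "c * (q * \<theta>) * f * 1 \<le> c * (q * \<theta>) * f * q ^ N"
      using qN q0 nonneg that by (intro mult_left_mono) auto
    then show ?thesis by (simp add: algebra_simps)
  qed
  show ?case
  proof (cases p)
    case 0
    have "d 0 (Suc N) \<le> q * d 0 N + c * (q * \<theta>)"
      using Suc.prems step0 by simp
    also have "\<dots> \<le> q * (c * q ^ N * (x - \<epsilon>)) + c * q ^ Suc N * \<theta>"
      using IH[of 0] absorb[of 1] q0 by (intro add_mono mult_left_mono) auto
    also have "\<dots> = c * q ^ Suc N * ((x + \<theta>) - \<epsilon>)"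
      by (simp add: algebra_simps)
    finally show ?thesis using 0 x_Suc by simp
  next
    case (Suc m)
    then have m: "m < k" using Suc.prems by simp
    define F :: real where "F = fact (Suc m)"
    have F: "F > 0" and F_Suc: "fact (Suc (Suc m)) = real (Suc (Suc m)) * F"
      by (simp_all add: F_def)
    have "d (Suc m) (Suc N) \<le> q * d (Suc m) N + q * \<theta> * d m N + c * (q * \<theta>) * (\<epsilon> ^ Suc m / F)"
      using Suc.prems m step by (simp add: F_def)
    also have "\<dots> \<le> q * (c * q ^ N * ((x ^ Suc (Suc m) - \<epsilon> ^ Suc (Suc m)) / (real (Suc (Suc m)) * F)))
        + q * \<theta> * (c * q ^ N * ((x ^ Suc m - \<epsilon> ^ Suc m) / F)) + c * q ^ Suc N * (\<theta> * (\<epsilon> ^ Suc m / F))"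
      using IH[of "Suc m", unfolded F_Suc] IH[of m, folded F_def] absorb[of "\<epsilon> ^ Suc m / F"] m q0 nonneg F
      by (intro add_mono mult_left_mono) auto
    \<comment> \<open>The forcing cancels the \<open>- \<epsilon> ^ Suc m\<close> coming from the
      bound on \<open>d m N\<close>, so only \<open>x ^ Suc m\<close> survives.\<close>
    also have "\<dots> = c * q ^ Suc N *
        ((x ^ Suc (Suc m) - \<epsilon> ^ Suc (Suc m)) / (real (Suc (Suc m)) * F) + \<theta> * x ^ Suc m / F)"
      using F by (simp add: algebra_simps diff_divide_distrib)
    also have "(x ^ Suc (Suc m) - \<epsilon> ^ Suc (Suc m)) / (real (Suc (Suc m)) * F) + \<theta> * x ^ Suc m / F
        = (x ^ Suc (Suc m) + real (Suc (Suc m)) * \<theta> * x ^ Suc m - \<epsilon> ^ Suc (Suc m)) / (real (Suc (Suc m)) * F)"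
    proof -
      have "a / (r * F) + b / F = (a + r * b) / (r * F)" if "r \<noteq> 0" for a b r
        using F that by (simp add: field_simps)
      from this[of "real (Suc (Suc m))"] show ?thesis
        by (simp add: algebra_simps del: of_nat_Suc)
    qed
    \<comment> \<open>The numerator now contains the first two terms of
      \<open>(x + \<theta>) ^ Suc (Suc m)\<close>.\<close>
    also have "c * q ^ Suc N * \<dots>
        \<le> c * q ^ Suc N * (((x + \<theta>) ^ Suc (Suc m) - \<epsilon> ^ Suc (Suc m)) / (real (Suc (Suc m)) * F))"
      using power_Suc_add_ge[OF x nonneg(3), of "Suc m"] nonneg q0 F
      by (intro mult_left_mono divide_right_mono) auto
    finally show ?thesis unfolding Suc x_Suc F_Suc .
  qed
qed

text \<open>Uniqueness identifies \<open>u\<close> with the trajectory of \<open>E\<close> started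
  at time 0, and the semigroup property restarts that trajectory at a grid point.\<close>

lemma exact_propagator_grid_step:
  assumes T: "T > 0" and n: "n \<ge> 1" and h: "\<Delta>T = T / real n"
    and exact: "exact_propagator A T E" and semigroup: "semigroup_property T E"
    and u: "evolution_solution A T 0 (u 0) u" and N: "N < n"
  shows "u (real (Suc N) * \<Delta>T) = E (real N * \<Delta>T) \<Delta>T (u (real N * \<Delta>T))"
proof -
  have h0: "\<Delta>T > 0" using T n h by simp
  have uE: "u r = E 0 r (u 0)" if "0 \<le> r" "r \<le> T" for r
  proof -
    have start: "0 \<in> {0..T}" using T by simp
    note unique = exact[unfolded exact_propagator_def, THEN bspec, OF start, THEN spec, THEN conjunct2,
        THEN spec, THEN mp, OF u]
    from unique[THEN bspec, of r] show ?thesis using that by simp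
  qed
  have "real (Suc N) * \<Delta>T \<le> real n * \<Delta>T"
    using N h0 by (intro mult_right_mono) auto
  then have le: "real (Suc N) * \<Delta>T \<le> T" using n h by simp
  show ?thesis
  \<comment> \<open>The semigroup property is stated for strictly ordered times only, so the first
    subinterval is read off from uniqueness directly.\<close>
  proof (cases "N = 0")
    case True
    then show ?thesis using uE[of \<Delta>T] le h0 by simp
  next
    case False
    define s t where "s = real N * \<Delta>T" and "t = real (Suc N) * \<Delta>T"
    have "0 < s" "s < t" "t \<le> T" and ts: "t - s = \<Delta>T"
      using False h0 le by (auto simp: s_def t_def algebra_simps)
    then have "E 0 (t - 0) (u 0) = E s (t - s) (E 0 (s - 0) (u 0))"
      using semigroup unfolding semigroup_property_def by blast
    then have "u t = E s \<Delta>T (u s)"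
      using uE[of s] uE[of t] ts \<open>0 < s\<close> \<open>s < t\<close> \<open>t \<le> T\<close> by simp
    then show ?thesis unfolding s_def t_def .
  qed
qed

theorem theorem2p2:
  fixes A :: "real \<Rightarrow> 'u::banach \<Rightarrow> 'u"
    and E G \<delta>G :: "real \<Rightarrow> real \<Rightarrow> 'u \<Rightarrow> 'u"
    and u :: "real \<Rightarrow> 'u"
    and T \<Delta>T \<epsilon> C\<^sub>c C\<^sub>d :: real
    and n k :: nat
    and \<zeta> :: "nat \<Rightarrow> nat \<Rightarrow> real"
    and \<nu> :: "nat \<Rightarrow> real"
    and e y :: "nat \<Rightarrow> nat \<Rightarrow> 'u"
    and \<mu> \<tau> \<tau>' :: real
  assumes "T > 0" and "n \<ge> 1" and "\<Delta>T = T / real n"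
    and "exact_propagator A T E"
    and "semigroup_property T E"
    and "evolution_solution A T 0 (u 0) u"
    and "\<epsilon> > 0" and "C\<^sub>c > 0" and "C\<^sub>d > 0"
    and "\<And>t s x. \<delta>G t s x = E t s x - G t s x"
    and "\<And>t s x. \<lbrakk>t \<in> {0..<T}; s \<in> {0..T - t}\<rbrakk> \<Longrightarrow>
           norm (\<delta>G t s x) \<le> s * (1 + norm x) * \<epsilon>"
    and "\<And>t s x y. \<lbrakk>t \<in> {0..<T}; s \<in> {0..T - t}\<rbrakk> \<Longrightarrow>
           norm (G t s x - G t s y) \<le> (1 + C\<^sub>c * s) * norm (x - y)"
    and "\<And>t s x y. \<lbrakk>t \<in> {0..<T}; s \<in> {0..T - t}\<rbrakk> \<Longrightarrow>
           norm (\<delta>G t s x - \<delta>G t s y) \<le> C\<^sub>d * s * \<epsilon> * norm (x - y)"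
    and "feasible_parareal E G \<Delta>T n (u 0) \<zeta> e y"
    and "\<And>p. \<nu> p = (MAX N\<in>{0..n}. 1 + norm (y p N)) /
                   (MAX N\<in>{0..n}. 1 + norm (u (real N * \<Delta>T)))"
    and "\<And>p N. \<lbrakk>p < k; N < n\<rbrakk> \<Longrightarrow> \<zeta> p N \<le> \<epsilon> ^ (p + 2) / (fact (p + 1) * \<nu> p)"
    and "\<mu> = exp (C\<^sub>c * T) / C\<^sub>d * (MAX N\<in>{0..n}. 1 + norm (u (real N * \<Delta>T)))"
    and "\<tau> = C\<^sub>d * T * exp (- C\<^sub>c * \<Delta>T) * \<epsilon>"
    and "\<tau>' = \<tau> + \<epsilon>"
  shows "(MAX N\<in>{0..n}. norm (u (real N * \<Delta>T) - y k N)) \<le> \<mu> * \<tau>' ^ (k + 1) / fact (k + 1)"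
proof -
  define M where "M = (MAX N\<in>{0..n}. 1 + norm (u (real N * \<Delta>T)))"
  define Y where "Y p = (MAX N\<in>{0..n}. 1 + norm (y p N))" for p
  \<comment> \<open>\<open>q\<close> replaces the Lipschitz constant
    \<open>1 + C\<^sub>c * \<Delta>T\<close> so that \<open>q ^ n\<close> equals
    \<open>exp (C\<^sub>c * T)\<close>. Dividing by \<open>q\<close> in \<open>\<theta>\<close>
    produces the factor \<open>exp (- C\<^sub>c * \<Delta>T)\<close> of
    \<open>\<tau>\<close>.\<close>
  define q where "q = exp (C\<^sub>c * \<Delta>T)"
  define \<theta> where "\<theta> = C\<^sub>d * \<Delta>T * \<epsilon> / q"
  define tt where "tt N = real N * \<Delta>T" for N
  define d where "d p N = norm (u (tt N) - y p N)" for p N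
  have \<Delta>T: "\<Delta>T > 0" and nT: "real n * \<Delta>T = T"
    using assms(1-3) by auto
  have M_ge: "1 + norm (u (tt N)) \<le> M" if "N \<le> n" for N
    unfolding M_def tt_def using that by (intro Max_ge) auto
  have Y_ge: "1 + norm (y p N) \<le> Y p" if "N \<le> n" for p N
    unfolding Y_def using that by (intro Max_ge) auto
  have M_pos: "M > 0"
    using M_ge[of 0] norm_ge_zero[of "u (tt 0)"] by linarith
  have Y_pos: "Y p > 0" for p
    using Y_ge[of 0 p] norm_ge_zero[of "y p 0"] by linarith
  have q1: "1 \<le> q" and q_ge: "1 + C\<^sub>c * \<Delta>T \<le> q"
    using assms(8) \<Delta>T by (auto simp: q_def)
  have q\<theta>: "q * \<theta> = C\<^sub>d * \<Delta>T * \<epsilon>"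
    by (simp add: \<theta>_def q_def)
  have \<theta>0: "0 \<le> \<theta>"
    using assms(7,9) \<Delta>T q1 by (simp add: \<theta>_def)
  have forcing: "M / C\<^sub>d * (q * \<theta>) = \<Delta>T * M * \<epsilon>"
    using assms(9) unfolding q\<theta> by (simp add: field_simps)
  have in_range: "tt N \<in> {0..<T}" "\<Delta>T \<in> {0..T - tt N}" if "N < n" for N
  proof -
    have "real (Suc N) * \<Delta>T \<le> real n * \<Delta>T"
      using that \<Delta>T by (intro mult_right_mono) auto
    then show "tt N \<in> {0..<T}" "\<Delta>T \<in> {0..T - tt N}"
      using \<Delta>T nT by (auto simp: tt_def algebra_simps)
  qed
  have u_step: "u (tt (Suc N)) = E (tt N) \<Delta>T (u (tt N))" if "N < n" for N
    unfolding tt_def using exact_propagator_grid_step[OF assms(1-6) that] .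
  have lip: "norm (G (tt N) \<Delta>T v - G (tt N) \<Delta>T w) \<le> q * norm (v - w)" if "N < n" for N v w
    using assms(12)[OF in_range[OF that], of v w] mult_right_mono[OF q_ge, of "norm (v - w)"]
    by simp
  note scheme = assms(14)[unfolded feasible_parareal_def, folded tt_def]
  have "d k N \<le> M / C\<^sub>d * q ^ N * (((\<epsilon> + real N * \<theta>) ^ Suc k - \<epsilon> ^ Suc k) / fact (Suc k))"
    if "N \<le> n" for N
  proof (rule two_index_recurrence_bound[where d = d and k = k and n = n])
    show "d p 0 \<le> 0" if "p \<le> k" for p
      using scheme by (simp add: d_def tt_def)
    show "d 0 (Suc N) \<le> q * d 0 N + M / C\<^sub>d * (q * \<theta>)" if N: "N < n" for N
    proof -
      have "u (tt (Suc N)) - y 0 (Suc N) =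
          (G (tt N) \<Delta>T (u (tt N)) - G (tt N) \<Delta>T (y 0 N)) + \<delta>G (tt N) \<Delta>T (u (tt N))"
        using scheme N by (simp add: u_step assms(10))
      then have "d 0 (Suc N) \<le> norm (G (tt N) \<Delta>T (u (tt N)) - G (tt N) \<Delta>T (y 0 N))
          + norm (\<delta>G (tt N) \<Delta>T (u (tt N)))"
        unfolding d_def by (simp add: norm_triangle_ineq)
      moreover have "norm (\<delta>G (tt N) \<Delta>T (u (tt N))) \<le> \<Delta>T * M * \<epsilon>"
      proof -
        have "norm (\<delta>G (tt N) \<Delta>T (u (tt N))) \<le> \<Delta>T * (1 + norm (u (tt N))) * \<epsilon>"
          using assms(11)[OF in_range[OF N]] .
        also have "\<dots> \<le> \<Delta>T * M * \<epsilon>"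
          using M_ge[of N] N \<Delta>T assms(7) by (intro mult_right_mono mult_left_mono) auto
        finally show ?thesis .
      qed
      ultimately show ?thesis
        using lip[OF N, of "u (tt N)" "y 0 N"] unfolding forcing d_def by linarith
    qed
    show "d (Suc p) (Suc N) \<le> q * d (Suc p) N + q * \<theta> * d p N
        + M / C\<^sub>d * (q * \<theta>) * (\<epsilon> ^ Suc p / fact (Suc p))" if p: "p < k" and N: "N < n" for p N
    proof -
      let ?a = "G (tt N) \<Delta>T (u (tt N)) - G (tt N) \<Delta>T (y (Suc p) N)"
      let ?b = "\<delta>G (tt N) \<Delta>T (u (tt N)) - \<delta>G (tt N) \<Delta>T (y p N)"
      let ?c = "E (tt N) \<Delta>T (y p N) - e p N"
      \<comment> \<open>Adding and subtracting the exact value at \<open>y p N\<close> separates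
        coarse propagation of the new error, the correction's dependence on the old error, and the
        inexact fine solve.\<close>
      have "u (tt (Suc N)) - y (Suc p) (Suc N) = ?a + ?b + ?c"
        using scheme N by (simp add: u_step assms(10))
      then have "d (Suc p) (Suc N) \<le> norm ?a + norm ?b + norm ?c"
        unfolding d_def by (metis norm_triangle_le norm_triangle_ineq add_right_mono)
      moreover have "norm ?b \<le> q * \<theta> * d p N"
        using assms(13)[OF in_range[OF N]] unfolding q\<theta> d_def .
      moreover have "norm ?c \<le> \<Delta>T * M * \<epsilon> * (\<epsilon> ^ Suc p / fact (Suc p))"
      proof -
        have \<nu>: "\<nu> p = Y p / M"
          using assms(15) by (simp add: Y_def M_def)
        have "norm ?c \<le> \<zeta> p N * \<Delta>T * (1 + norm (y p N))"
          using scheme N by (simp add: approximates_def)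
        also have "\<dots> \<le> \<zeta> p N * \<Delta>T * Y p"
          using scheme N \<Delta>T Y_ge[of N p] by (intro mult_left_mono) (auto simp: less_imp_le)
        \<comment> \<open>The division by \<open>\<nu> p\<close> in the tolerance trades the
          iterate-dependent \<open>Y p\<close> for the fixed \<open>M\<close>.\<close>
        also have "\<dots> \<le> \<epsilon> ^ (p + 2) / (fact (p + 1) * \<nu> p) * \<Delta>T * Y p"
          using assms(16)[OF p N] \<Delta>T Y_pos[of p] by (intro mult_right_mono) auto
        also have "\<dots> = \<Delta>T * M * \<epsilon> * (\<epsilon> ^ Suc p / fact (Suc p))"
          unfolding \<nu> using M_pos Y_pos[of p] by (simp add: field_simps del: fact_Suc)
        finally show ?thesis .
      qed
      ultimately show ?thesis
        using lip[OF N, of "u (tt N)" "y (Suc p) N"] unfolding forcing d_def by linarith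
    qed
  qed (use q1 \<theta>0 M_pos assms(7,9) that in auto)
  moreover have "M / C\<^sub>d * q ^ N * (((\<epsilon> + real N * \<theta>) ^ Suc k - \<epsilon> ^ Suc k) / fact (Suc k))
      \<le> \<mu> * \<tau>' ^ (k + 1) / fact (k + 1)" if N: "N \<le> n" for N
  proof -
    have "q ^ N \<le> q ^ n"
      using q1 N by (intro power_increasing)
    also have "q ^ n = exp (C\<^sub>c * T)"
      unfolding q_def exp_of_nat_mult[symmetric] nT[symmetric] by (simp add: mult_ac)
    finally have qN: "q ^ N \<le> exp (C\<^sub>c * T)" .
    have "real n * \<theta> = C\<^sub>d * (real n * \<Delta>T) * \<epsilon> / q"
      by (simp add: \<theta>_def)
    then have n\<theta>: "real n * \<theta> = \<tau>"
      unfolding assms(18) nT q_def by (simp add: exp_minus field_simps)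
    have "real N * \<theta> \<le> real n * \<theta>"
      using N \<theta>0 by (intro mult_right_mono) auto
    then have "(\<epsilon> + real N * \<theta>) ^ Suc k \<le> \<tau>' ^ Suc k"
      using assms(7,19) \<theta>0 n\<theta> by (intro power_mono) auto
    \<comment> \<open>The first fact allows the subtracted power to be discarded; the second keeps
      the numerator nonnegative, so that the factors can be bounded separately.\<close>
    moreover have "0 \<le> \<epsilon> ^ Suc k" and "\<epsilon> ^ Suc k \<le> (\<epsilon> + real N * \<theta>) ^ Suc k"
      using assms(7) \<theta>0 by (auto intro!: power_mono simp del: power_Suc)
    ultimately have "M / C\<^sub>d * q ^ N * (((\<epsilon> + real N * \<theta>) ^ Suc k - \<epsilon> ^ Suc k) / fact (Suc k))
        \<le> M / C\<^sub>d * exp (C\<^sub>c * T) * (\<tau>' ^ Suc k / fact (Suc k))"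
      using qN M_pos assms(9) q1 by (intro mult_mono divide_right_mono) (auto simp del: power_Suc)
    also have "\<dots> = \<mu> * \<tau>' ^ (k + 1) / fact (k + 1)"
      unfolding assms(17) M_def[symmetric] by (simp del: fact_Suc)
    finally show ?thesis .
  qed
  ultimately have "norm (u (tt N) - y k N) \<le> \<mu> * \<tau>' ^ (k + 1) / fact (k + 1)" if "N \<le> n" for N
    using that unfolding d_def by (meson order_trans)
  then show ?thesis
    by (intro Max.boundedI) (auto simp: tt_def)
qed

end
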